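(* Let $\mathbb{F}$ be a finite field with $q>2$ elements, let $k\geq 2$ be an integer, let $X\subseteq \mathbb{P}^{2k-1}$ be the projective toric subset parameterized by a cycle of length $2k\geq 4$, let $m=|X|=(q-1)^{2k-2}$, and let $C=C_X(1)\subseteq \mathbb{F}^m$ be the corresponding parameterized (evaluation) code of order $1$. Then the minimum distance of $C$ is $$ \begin{cases} (q-1)^{2k-3}(q-2), & \text{if } k=4 \text{ and } q>3, \text{ or } k\geq 5,\\[4pt] \dfrac{(q-1)^{2k}-q^k(q-2)-1}{q(q-1)}, & \text{if } k=2, \text{ or } k=3, \text{ or } k=4 \text{ and } q=3. \end{cases} $$
   Context: $\mathbb{F}^*=\mathbb{F}\setminus\{0\}$, and $\mathbb{P}^{2k-1}$ is projective space over $\mathbb{F}$ (its $\mathbb{F}$-rational points). The projective toric subset parameterized by the cycle of length $2k$ is $$X=\{(x_1x_2:x_2x_3:\cdots:x_{2k-1}x_{2k}:x_{2k}x_1)\in\mathbb{P}^{2k-1} : x_i\in\mathbb{F}^*,\ 1\leq i\leq 2k\}.$$ All points of $X$ have only nonzero coordinates. Let $S=\mathbb{F}[t_1,\dots,t_{2k}]$ with the standard grading and let $S_1$ be its space of linear forms. Choose an ordering $X=\{P_1,\dots,P_m\}$ of the points of $X$. The code $C_X(1)$ is the image of the linear map $\mathrm{ev}_1\colon S_1\to\mathbb{F}^m$, $F\mapsto\left(\frac{F}{t_1}(P_1),\dots,\frac{F}{t_1}(P_m)\right)$. The minimum distance of a nonzero linear code $C\subseteq\mathbb{F}^m$ is $\min\{\|\mathbf{w}\|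 : 0\neq\mathbf{w}\in C\}$, where $\|\mathbf{w}\|$ is the Hamming weight, i.e. the number of nonzero entries of $\mathbf{w}$. *)

theory Defs
  imports
    "HOL-Library.Cardinality"
    "HOL-Library.Poly_Mapping"
    "Jordan_Normal_Form.Matrix"
begin

section \<open>Projective space\<close>

text \<open>Vectors of length \<open>n\<close> are elements of \<open>carrier_vec n\<close>, so all coordinates and all
  variables are numbered from 0: the coordinate \<open>t\<^sub>1\<close> of the mathematical text has index 0 here.\<close>

definition proj_rel :: "nat \<Rightarrow> ('a::field vec \<times> 'a vec) set" where
  "proj_rel n = {(u, v). u \<in> carrier_vec n - {0\<^sub>v n} \<and> v \<in> carrier_vec n - {0\<^sub>v n} \<and>
     (\<exists>c. c \<noteq> 0 \<and> v = c \<cdot>\<^sub>v u)}"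

text \<open>\<open>proj_space n\<close> is the projective space of dimension \<open>n - 1\<close>, as it has \<open>n\<close> homogeneous
  coordinates.\<close>

definition proj_space :: "nat \<Rightarrow> 'a::field vec set set" where
  "proj_space n = (carrier_vec n - {0\<^sub>v n}) // proj_rel n"

definition proj_point :: "'a::field vec \<Rightarrow> 'a vec set" where
  "proj_point v = proj_rel (dim_vec v) `` {v}"

definition cycle_toric_set :: "nat \<Rightarrow> 'a::field vec set set" where
  "cycle_toric_set k =
     {proj_point (vec (2 * k) (\<lambda>i. x i * x (Suc i mod (2 * k)))) | x. \<forall>i<2 * k. x i \<noteq> 0}"

section \<open>Forms\<close>

text \<open>Polynomials over \<open>'a\<close> in variables indexed by the natural numbers: a monomial is a finitely
  supported exponent function, a polynomial a finitely supported coefficient function on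
  monomials.\<close>

type_synonym 'a mpoly = "(nat \<Rightarrow>\<^sub>0 nat) \<Rightarrow>\<^sub>0 'a"

definition var :: "nat \<Rightarrow> 'a::field mpoly" where
  "var i = Poly_Mapping.single (Poly_Mapping.single i 1) 1"

definition eval :: "'a::field mpoly \<Rightarrow> 'a vec \<Rightarrow> 'a" where
  "eval F v = (\<Sum>e\<in>Poly_Mapping.keys F. Poly_Mapping.lookup F e * (\<Prod>i\<in>Poly_Mapping.keys e. v $ i ^ Poly_Mapping.lookup e i))"

text \<open>The degree \<open>d\<close> part of the polynomial ring in the variables \<open>var 0, \<dots>, var (n - 1)\<close>,
  including the zero polynomial.\<close>

definition forms :: "nat \<Rightarrow> nat \<Rightarrow> 'a::field mpoly set" where
  "forms n d = {F. \<forall>e\<in>Poly_Mapping.keys F. Poly_Mapping.keys e \<subseteq> {..<n} \<and> (\<Sum>i\<in>Poly_Mapping.keys e. Poly_Mapping.lookup e i) = d}"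

text \<open>The value of \<open>F / G\<close> at a projective point, for forms \<open>F\<close>, \<open>G\<close> of the same degree. It is the
  same for all representatives \<open>v\<close>, see \<open>eval_quotient_proj_point\<close>.\<close>

definition eval_quotient :: "'a::field mpoly \<Rightarrow> 'a mpoly \<Rightarrow> 'a vec set \<Rightarrow> 'a" where
  "eval_quotient F G p = the_elem ((\<lambda>v. eval F v / eval G v) ` p)"

section \<open>Codes\<close>

definition ev1 :: "nat \<Rightarrow> (nat \<Rightarrow> 'a vec set) \<Rightarrow> 'a::field mpoly \<Rightarrow> 'a vec" where
  "ev1 m P F = vec m (\<lambda>j. eval_quotient F (var 0) (P j))"

text \<open>The code of order 1 on the points \<open>P 0, \<dots>, P (m - 1)\<close> in projective space with \<open>n\<close>
  homogeneous coordinates.\<close>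

definition eval_code1 :: "nat \<Rightarrow> nat \<Rightarrow> (nat \<Rightarrow> 'a vec set) \<Rightarrow> 'a::field vec set" where
  "eval_code1 n m P = ev1 m P ` forms n 1"

definition hamming_weight :: "'a::zero vec \<Rightarrow> nat" where
  "hamming_weight w = card {j. j < dim_vec w \<and> w $ j \<noteq> 0}"

text \<open>For a nonzero code the infimum is a minimum; for the zero code it has the value 0.\<close>

definition min_distance :: "'a::zero vec set \<Rightarrow> nat" where
  "min_distance C = Inf (hamming_weight ` {w \<in> C. w \<noteq> 0\<^sub>v (dim_vec w)})"

section \<open>Well-definedness\<close>

lemma equiv_proj_rel:
  "equiv (carrier_vec n - {0\<^sub>v n}) (proj_rel n :: ('a::field vec \<times> 'a vec) set)"
proof (rule equivI)
  show "(proj_rel n :: ('a vec \<times> 'a vec) set) \<subseteq> 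
    (carrier_vec n - {0\<^sub>v n}) \<times> (carrier_vec n - {0\<^sub>v n})"
    by (auto simp: proj_rel_def)
  show "refl_on (carrier_vec n - {0\<^sub>v n}) (proj_rel n :: ('a vec \<times> 'a vec) set)"
    unfolding refl_on_def proj_rel_def by (auto intro!: exI[of _ 1])
  show "sym (proj_rel n :: ('a vec \<times> 'a vec) set)"
  proof (rule symI)
    fix u v :: "'a vec" assume "(u, v) \<in> proj_rel n"
    then obtain c where *: "u \<in> carrier_vec n - {0\<^sub>v n}" "v \<in> carrier_vec n - {0\<^sub>v n}"
      "c \<noteq> 0" "v = c \<cdot>\<^sub>v u" by (auto simp: proj_rel_def)
    then have "u = inverse c \<cdot>\<^sub>v v" by (simp add: smult_smult_assoc)
    moreover have "inverse c \<noteq> 0" using * by simp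
    ultimately show "(v, u) \<in> proj_rel n" using *(1,2) unfolding proj_rel_def by blast
  qed
  show "trans (proj_rel n :: ('a vec \<times> 'a vec) set)"
  proof (rule transI)
    fix u v w :: "'a vec" assume "(u, v) \<in> proj_rel n" "(v, w) \<in> proj_rel n"
    then obtain c d where *: "u \<in> carrier_vec n - {0\<^sub>v n}" "w \<in> carrier_vec n - {0\<^sub>v n}"
      "c \<noteq> 0" "d \<noteq> 0" "v = c \<cdot>\<^sub>v u" "w = d \<cdot>\<^sub>v v"
      unfolding proj_rel_def by blast
    then have "w = (d * c) \<cdot>\<^sub>v u" by (simp add: smult_smult_assoc)
    moreover have "d * c \<noteq> 0" using * by simp
    ultimately show "(u, w) \<in> proj_rel n" using *(1,2) unfolding proj_rel_def by blast
  qed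
qed

lemma cycle_toric_set_subset: "k > 0 \<Longrightarrow> cycle_toric_set k \<subseteq> proj_space (2 * k)"
proof
  fix p :: "'a vec set" assume k: "k > 0" and "p \<in> cycle_toric_set k"
  then obtain x where p: "p = proj_point (vec (2 * k) (\<lambda>i. x i * x (Suc i mod (2 * k))))"
    and x: "\<forall>i<2 * k. x i \<noteq> 0" by (auto simp: cycle_toric_set_def)
  let ?v = "vec (2 * k) (\<lambda>i. x i * x (Suc i mod (2 * k)))"
  have "?v $ 0 \<noteq> 0" using k x by auto
  then have "?v \<noteq> 0\<^sub>v (2 * k)" using k by (metis index_zero_vec(1) mult_pos_pos zero_less_numeral)
  then have "?v \<in> carrier_vec (2 * k) - {0\<^sub>v (2 * k)}" by simp
  from quotientI[OF this, of "proj_rel (2 * k)"] show "p \<in> proj_space (2 * k)"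
    unfolding p proj_point_def proj_space_def dim_vec .
qed

lemma eval_smult:
  assumes "F \<in> forms n d" and "dim_vec v = n"
  shows "eval F (c \<cdot>\<^sub>v v) = c ^ d * eval F v"
  unfolding eval_def sum_distrib_left
proof (rule sum.cong[OF refl])
  fix e assume "e \<in> Poly_Mapping.keys F"
  then have e: "Poly_Mapping.keys e \<subseteq> {..<n}" "(\<Sum>i\<in>Poly_Mapping.keys e. Poly_Mapping.lookup e i) = d"
    using assms by (auto simp: forms_def)
  have "(\<Prod>i\<in>Poly_Mapping.keys e. (c \<cdot>\<^sub>v v) $ i ^ Poly_Mapping.lookup e i)
      = (\<Prod>i\<in>Poly_Mapping.keys e. c ^ Poly_Mapping.lookup e i * v $ i ^ Poly_Mapping.lookup e i)"
    using e assms by (intro prod.cong) (auto simp: power_mult_distrib subset_iff)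
  also have "\<dots> = c ^ d * (\<Prod>i\<in>Poly_Mapping.keys e. v $ i ^ Poly_Mapping.lookup e i)"
    by (simp add: prod.distrib power_sum[symmetric] e)
  finally show "Poly_Mapping.lookup F e * (\<Prod>i\<in>Poly_Mapping.keys e. (c \<cdot>\<^sub>v v) $ i ^ Poly_Mapping.lookup e i)
      = c ^ d * (Poly_Mapping.lookup F e * (\<Prod>i\<in>Poly_Mapping.keys e. v $ i ^ Poly_Mapping.lookup e i))" by simp
qed

lemma eval_quotient_proj_point:
  assumes "F \<in> forms n d" "G \<in> forms n d" "v \<in> carrier_vec n" "v \<noteq> 0\<^sub>v n"
  shows "eval_quotient F G (proj_point v) = eval F v / eval G v"
proof -
  have "(\<lambda>v. eval F v / eval G v) ` proj_point v = {eval F v / eval G v}"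
  proof (rule equalityI; rule subsetI)
    fix y assume "y \<in> (\<lambda>v. eval F v / eval G v) ` proj_point v"
    then obtain c where "c \<noteq> 0" "y = eval F (c \<cdot>\<^sub>v v) / eval G (c \<cdot>\<^sub>v v)"
      by (auto simp: proj_point_def proj_rel_def)
    then show "y \<in> {eval F v / eval G v}" using assms by (simp add: eval_smult)
  next
    fix y assume "y \<in> {eval F v / eval G v}"
    moreover have "v \<in> proj_point v"
      using assms equiv_class_self[OF equiv_proj_rel, of v n] by (auto simp: proj_point_def)
    ultimately show "y \<in> (\<lambda>v. eval F v / eval G v) ` proj_point v" by blast
  qed
  then show ?thesis by (simp add: eval_quotient_def)
qed

lemma var_in_forms: "i < n \<Longrightarrow> var i \<in> forms n 1"
  by (simp add: forms_def var_def)

lemma eval_var: "eval (var i) v = v $ i"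
  by (simp add: eval_def var_def)

end

theory Submission
  imports Defs
begin

text \<open>The affine cone over the toric set consists of the vectors with nonzero entries and alternating
  product \<open>y\<^sub>0 y\<^sub>1\<^sup>-\<^sup>1 y\<^sub>2 y\<^sub>3\<^sup>-\<^sup>1 \<cdots> = 1\<close>, so \<open>q - 1\<close> times the weight of a codeword counts the points of the cone
  where a linear form does not vanish.

  If some coefficient of the form is zero, that variable is determined by the product condition and
  a second one by the form, which leaves at most \<open>(q - 1)\<^sup>2\<^sup>k\<^sup>-\<^sup>2\<close> zeros, with equality for
  \<open>t\<^sub>1 - t\<^sub>2\<close>. If all coefficients are nonzero, the number of solutions with prescribed alternating
  product and prescribed value of the form depends only on whether the value is 0 and whether the
  product equals one particular constant; it follows by induction on \<open>k\<close>, adding two variables at a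
  time, and is largest for coefficients alternating between \<open>1\<close> and \<open>- 1\<close>. The minimum distance is
  decided by comparing \<open>(q - 1)\<^sup>2\<^sup>k\<^sup>-\<^sup>2\<close> with \<open>q\<^sup>k (q - 2) + 1\<close>.\<close>

section \<open>Vectors with prescribed alternating product\<close>

text \<open>The exponents 1 and -1 alternate with the parity of the index. Being a multiplicative
  involution in \<open>x\<close>, the function lets a coordinate be solved for in the same way at
  even and odd positions.\<close>

definition alt_inverse :: "nat \<Rightarrow> 'a::field \<Rightarrow> 'a" where
  "alt_inverse i x = (if even i then x else inverse x)"

text \<open>For \<open>n = 2 * k\<close> and \<open>c = 1\<close> this is the affine cone over the
  toric set. General \<open>c\<close> is there for the induction that splits off two coordinates and
  changes the product. Extensional functions make the set finite over a finite field and make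
  restriction to fewer indices invertible.\<close>

definition balanced :: "nat \<Rightarrow> 'a::field \<Rightarrow> (nat \<Rightarrow> 'a) set" where
  "balanced n c = {y \<in> {..<n} \<rightarrow>\<^sub>E - {0}. (\<Prod>i<n. alt_inverse i (y i)) = c}"

lemma alt_inverse_eq_0_iff [simp]: "alt_inverse i x = 0 \<longleftrightarrow> x = 0"
  by (simp add: alt_inverse_def)

lemma alt_inverse_alt_inverse [simp]: "alt_inverse i (alt_inverse i x) = x"
  by (simp add: alt_inverse_def)

lemma alt_inverse_1 [simp]: "alt_inverse i 1 = 1"
  by (simp add: alt_inverse_def)

lemma alt_inverse_mult: "alt_inverse i (x * y) = alt_inverse i x * alt_inverse i y"
  by (simp add: alt_inverse_def)

text \<open>The factors \<open>c\<close> and \<open>inverse c\<close> cancel in pairs because the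
  length is even. This makes the cone closed under scaling.\<close>

lemma prod_alt_inverse_const:
  "c \<noteq> 0 \<Longrightarrow> (\<Prod>i<2 * k. alt_inverse i (c::'a::field)) = 1"
  by (induction k) (simp_all add: alt_inverse_def)

lemma finite_balanced [simp]: "finite (balanced n (c::'a::{field,finite}))"
  by (simp add: balanced_def finite_PiE)

lemma card_nonzero: "card (- {0::'a::{field,finite}}) = CARD('a) - 1"
  by (simp add: Compl_eq_Diff_UNIV)

lemma card_torus:
  "finite I \<Longrightarrow> card (I \<rightarrow>\<^sub>E - {0::'a::{field,finite}}) = (CARD('a) - 1) ^ card I"
  by (simp add: card_PiE card_nonzero)

text \<open>The product condition determines coordinate \<open>f\<close> from the others, so
  forgetting it is a bijection onto a full torus. The property \<open>Q\<close> sees only the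
  remaining coordinates and is carried along.\<close>

lemma card_balanced_free_coordinate:
  fixes c :: "'a::{field,finite}"
  assumes f: "f < n" and c: "c \<noteq> 0"
  shows "card {y \<in> balanced n c. Q (restrict y ({..<n} - {f}))} =
    card {z \<in> ({..<n} - {f}) \<rightarrow>\<^sub>E - {0::'a}. Q z}"
proof (rule bij_betw_same_card)
  let ?J = "{..<n} - {f}"
  define p where "p z = (\<Prod>i\<in>?J. alt_inverse i (z i))" for z :: "nat \<Rightarrow> 'a"
  \<comment> \<open>The product condition reads \<open>alt_inverse f (y f) * p y = c\<close>;
    applying the involution \<open>alt_inverse f\<close> to \<open>c / p z\<close> solves it for the
    missing coordinate.\<close>
  define g where "g z = z(f := alt_inverse f (c / p z))" for z :: "nat \<Rightarrow> 'a"
  have prod: "(\<Prod>i<n. alt_inverse i (y i)) = alt_inverse f (y f) * p y" for y :: "nat \<Rightarrow> 'a"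
    unfolding p_def using f by (subst prod.remove[of _ f]) auto
  have p_cong: "p y = p z" if "\<And>i. i \<in> ?J \<Longrightarrow> y i = z i" for y z
    unfolding p_def by (rule prod.cong) (auto simp: that)
  have p0: "p z \<noteq> 0" if "\<And>i. i \<in> ?J \<Longrightarrow> z i \<noteq> 0" for z
    unfolding p_def using that by (subst prod_zero_iff) auto
  have pg: "p (g z) = p z" for z
    by (rule p_cong) (auto simp: g_def)
  show "bij_betw (\<lambda>y. restrict y ?J) {y \<in> balanced n c. Q (restrict y ?J)}
    {z \<in> ?J \<rightarrow>\<^sub>E - {0}. Q z}"
  proof (rule bij_betw_byWitness[where f' = g])
    show "\<forall>y\<in>{y \<in> balanced n c. Q (restrict y ?J)}. g (restrict y ?J) = y"
    proof (intro ballI ext)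
      fix y i assume "y \<in> {y \<in> balanced n c. Q (restrict y ?J)}"
      then have y: "y \<in> {..<n} \<rightarrow>\<^sub>E - {0}" "c = alt_inverse f (y f) * p y"
        using prod by (auto simp: balanced_def)
      have "p (restrict y ?J) = p y" by (rule p_cong) auto
      moreover have "p y \<noteq> 0" using y by (intro p0) auto
      moreover have "y i = undefined" if "i \<notin> {..<n}" using y(1) that by (rule PiE_arb)
      ultimately show "g (restrict y ?J) i = y i"
        using f y(2) by (cases "i = f"; cases "i < n") (simp_all add: g_def)
    qed
    show ext: "\<forall>z\<in>{z \<in> ?J \<rightarrow>\<^sub>E - {0}. Q z}. restrict (g z) ?J = z"
    proof (intro ballI ext)
      fix z i assume "z \<in> {z \<in> ?J \<rightarrow>\<^sub>E - {0}. Q z}"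
      then have "z \<in> ?J \<rightarrow>\<^sub>E - {0}" by simp
      from PiE_arb[OF this, of i] show "restrict (g z) ?J i = z i"
        by (cases "i \<in> ?J") (simp_all add: g_def)
    qed
    show "(\<lambda>y. restrict y ?J) ` {y \<in> balanced n c. Q (restrict y ?J)} \<subseteq>
        {z \<in> ?J \<rightarrow>\<^sub>E - {0}. Q z}"
    proof (rule image_subsetI)
      fix y assume y: "y \<in> {y \<in> balanced n c. Q (restrict y ?J)}"
      then have "y \<in> {..<n} \<rightarrow>\<^sub>E - {0}" by (simp add: balanced_def)
      then have "y i \<noteq> 0" if "i \<in> ?J" for i using PiE_mem[of y _ _ i] that by auto
      then show "restrict y ?J \<in> {z \<in> ?J \<rightarrow>\<^sub>E - {0}. Q z}"
        using y by (simp add: restrict_PiE_iff)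
    qed
    show "g ` {z \<in> ?J \<rightarrow>\<^sub>E - {0}. Q z} \<subseteq> {y \<in> balanced n c. Q (restrict y ?J)}"
    proof (rule image_subsetI)
      fix z assume z: "z \<in> {z \<in> ?J \<rightarrow>\<^sub>E - {0}. Q z}"
      then have z': "z \<in> ?J \<rightarrow>\<^sub>E - {0}" by simp
      have z0: "z i \<noteq> 0" if "i \<in> ?J" for i using PiE_mem[OF z' that] by simp
      have "(\<Prod>i<n. alt_inverse i (g z i)) = c"
        using p0[OF z0] by (simp add: prod pg) (simp add: g_def)
      moreover have "g z \<in> {..<n} \<rightarrow>\<^sub>E - {0}"
      proof (rule PiE_I)
        fix i assume "i \<in> {..<n}"
        then show "g z i \<in> - {0}"
          using z0[of i] c p0[OF z0] by (cases "i = f") (simp_all add: g_def)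
      next
        fix i assume "i \<notin> {..<n}"
        then have "i \<notin> ?J" "i \<noteq> f" using f by auto
        then show "g z i = undefined" using PiE_arb[OF z', of i] by (simp add: g_def)
      qed
      moreover have "restrict (g z) ?J = z" using bspec[OF ext z] .
      ultimately show "g z \<in> {y \<in> balanced n c. Q (restrict y ?J)}"
        using z by (simp add: balanced_def)
    qed
  qed
qed

lemma card_balanced:
  assumes "n > 0" "c \<noteq> 0"
  shows "card (balanced n (c::'a::{field,finite})) = (CARD('a) - 1) ^ (n - 1)"
proof -
  have "card (balanced n c) = card (({..<n} - {0}) \<rightarrow>\<^sub>E - {0::'a})"
    using card_balanced_free_coordinate[OF assms, of "\<lambda>_. True"] by simp
  also have "card ({..<n} - {0}) = n - 1" using assms by simp
  then have "card (({..<n} - {0}) \<rightarrow>\<^sub>E - {0::'a}) = (CARD('a) - 1) ^ (n - 1)"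
    by (simp add: card_torus)
  finally show ?thesis .
qed

section \<open>Forms with a vanishing coefficient\<close>

lemma card_torus_linear_zeros_le:
  fixes a :: "nat \<Rightarrow> 'a::{field,finite}"
  assumes "finite J" and i: "i \<in> J" "a i \<noteq> 0"
  shows "card {z \<in> J \<rightarrow>\<^sub>E - {0}. (\<Sum>j\<in>J. a j * z j) = 0} \<le> (CARD('a) - 1) ^ (card J - 1)"
proof -
  let ?Z = "{z \<in> J \<rightarrow>\<^sub>E - {0}. (\<Sum>j\<in>J. a j * z j) = 0}"
  \<comment> \<open>Since \<open>a i\<close> is nonzero, the equation determines coordinate
    \<open>i\<close> from the others. Only injectivity is available, as the value solved for may be
    0 and then lies outside the torus; hence an inequality.\<close>
  have "inj_on (\<lambda>z. restrict z (J - {i})) ?Z"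
  proof (rule inj_onI)
    fix y z assume y: "y \<in> ?Z" and z: "z \<in> ?Z"
      and eq: "restrict y (J - {i}) = restrict z (J - {i})"
    have eq': "y j = z j" if "j \<in> J - {i}" for j
      using fun_cong[OF eq, of j] that by auto
    have "a i * y i + (\<Sum>j\<in>J - {i}. a j * y j) = a i * z i + (\<Sum>j\<in>J - {i}. a j * z j)"
      using y z sum.remove[OF assms(1) i(1), of "\<lambda>j. a j * y j"]
        sum.remove[OF assms(1) i(1), of "\<lambda>j. a j * z j"] by simp
    moreover have "(\<Sum>j\<in>J - {i}. a j * y j) = (\<Sum>j\<in>J - {i}. a j * z j)"
      by (rule sum.cong) (use eq' in auto)
    ultimately have "y i = z i" using i by simp
    with eq' show "y = z" using y z by (intro PiE_ext[of y J "\<lambda>_. - {0}" z]) auto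
  qed
  then have "card ?Z \<le> card ((J - {i}) \<rightarrow>\<^sub>E - {0::'a})"
    by (rule card_inj_on_le) (auto simp: assms finite_PiE)
  then show ?thesis using assms by (simp add: card_torus)
qed

lemma linear_form_restrict:
  fixes a :: "nat \<Rightarrow> 'a::field"
  assumes "f < n" "a f = 0"
  shows "(\<Sum>i<n. a i * y i) = (\<Sum>i\<in>{..<n} - {f}. a i * restrict y ({..<n} - {f}) i)"
proof -
  have "(\<Sum>i<n. a i * y i) = (\<Sum>i\<in>{..<n} - {f}. a i * y i)"
    using assms by (subst sum.remove[of _ f]) auto
  then show ?thesis by simp
qed

text \<open>Two coordinates are lost one after the other: \<open>f\<close> to the product condition,
  which the form does not notice because \<open>a f = 0\<close>, and then \<open>i\<close> to the
  linear equation.\<close>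

lemma card_balanced_linear_zeros_le:
  fixes a :: "nat \<Rightarrow> 'a::{field,finite}"
  assumes "f < n" "a f = 0" "i < n" "a i \<noteq> 0" "c \<noteq> 0"
  shows "card {y \<in> balanced n c. (\<Sum>i<n. a i * y i) = 0} \<le> (CARD('a) - 1) ^ (n - 2)"
proof -
  let ?J = "{..<n} - {f}"
  have "card {y \<in> balanced n c. (\<Sum>i<n. a i * y i) = 0} =
      card {z \<in> ?J \<rightarrow>\<^sub>E - {0::'a}. (\<Sum>i\<in>?J. a i * z i) = 0}"
    unfolding linear_form_restrict[where a = a, OF assms(1,2)]
    using assms by (intro card_balanced_free_coordinate) auto
  also have "\<dots> \<le> (CARD('a) - 1) ^ (card ?J - 1)"
    using assms by (intro card_torus_linear_zeros_le[of _ i]) auto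
  also have "card ?J - 1 = n - 2" using assms by simp
  finally show ?thesis .
qed

text \<open>This serves to show that the preceding bound is attained. The equation
  \<open>y 0 = y 1\<close> always has a nonzero solution for \<open>y 0\<close>, so the injection
  used there becomes a bijection.\<close>

lemma card_balanced_equal_coordinates:
  fixes c :: "'a::{field,finite}"
  assumes n: "n > 2" and "c \<noteq> 0"
  shows "card {y \<in> balanced n c. y 0 = y 1} = (CARD('a) - 1) ^ (n - 2)"
proof -
  \<comment> \<open>Coordinate 2 absorbs the product condition; it exists because
    \<open>n > 2\<close> and does not occur in the equation \<open>y 0 = y 1\<close>.\<close>
  define J where "J = {..<n} - {2::nat}"
  have J: "0 \<in> J" "1 \<in> J" "finite J" "card J = n - 1"
    using n by (auto simp: J_def)
  have "card {y \<in> balanced n c. y 0 = y 1} = card {z \<in> J \<rightarrow>\<^sub>E - {0::'a}. z 0 = z 1}"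
  proof -
    have "restrict y J 0 = restrict y J 1 \<longleftrightarrow> y 0 = y 1" for y :: "nat \<Rightarrow> 'a"
      using J by simp
    then have "{y \<in> balanced n c. y 0 = y 1} =
        {y \<in> balanced n c. restrict y J 0 = restrict y J 1}"
      by blast
    then show ?thesis
      using card_balanced_free_coordinate[OF n \<open>c \<noteq> 0\<close>, of "\<lambda>z. z 0 = z 1", folded J_def]
      by (rule ssubst)
  qed
  also have "\<dots> = card ((J - {0}) \<rightarrow>\<^sub>E - {0::'a})"
  proof (rule bij_betw_same_card)
    let ?f = "\<lambda>z. restrict z (J - {0})" and ?g = "\<lambda>z. z(0 := z 1)"
    show "bij_betw ?f {z \<in> J \<rightarrow>\<^sub>E - {0}. z 0 = z 1} ((J - {0}) \<rightarrow>\<^sub>E - {0::'a})"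
    proof (rule bij_betw_byWitness[where f' = ?g])
      show "\<forall>z\<in>{z \<in> J \<rightarrow>\<^sub>E - {0::'a}. z 0 = z 1}. ?g (?f z) = z"
      proof (intro ballI ext)
        fix z i assume "z \<in> {z \<in> J \<rightarrow>\<^sub>E - {0::'a}. z 0 = z 1}"
        then have z: "z \<in> J \<rightarrow>\<^sub>E - {0}" and eq: "z 0 = z 1" by simp_all
        have "z i = undefined" if "i \<notin> J" using z that by (rule PiE_arb)
        moreover have "1 \<in> J - {0}" using J by simp
        ultimately show "?g (?f z) i = z i"
          using eq by (cases "i = 0"; cases "i \<in> J") simp_all
      qed
      show "\<forall>z\<in>(J - {0}) \<rightarrow>\<^sub>E - {0::'a}. ?f (?g z) = z"
      proof (intro ballI ext)
        fix z i assume z: "z \<in> (J - {0}) \<rightarrow>\<^sub>E - {0::'a}"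
        show "?f (?g z) i = z i"
          using PiE_arb[OF z, of i] by (cases "i \<in> J - {0}") simp_all
      qed
      show "?f ` {z \<in> J \<rightarrow>\<^sub>E - {0::'a}. z 0 = z 1} \<subseteq> (J - {0}) \<rightarrow>\<^sub>E - {0}"
      proof (rule image_subsetI)
        fix z assume "z \<in> {z \<in> J \<rightarrow>\<^sub>E - {0::'a}. z 0 = z 1}"
        then have z: "z \<in> J \<rightarrow>\<^sub>E - {0::'a}" by simp
        show "?f z \<in> (J - {0}) \<rightarrow>\<^sub>E - {0}"
          using PiE_mem[OF z] by (simp add: restrict_PiE_iff)
      qed
      show "?g ` ((J - {0}) \<rightarrow>\<^sub>E - {0::'a}) \<subseteq> {z \<in> J \<rightarrow>\<^sub>E - {0}. z 0 = z 1}"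
      proof (rule image_subsetI)
        fix z assume z: "z \<in> (J - {0}) \<rightarrow>\<^sub>E - {0::'a}"
        have "z 1 \<noteq> 0" using PiE_mem[OF z, of 1] J by simp
        have "?g z \<in> J \<rightarrow>\<^sub>E - {0}"
        proof (rule PiE_I)
          fix i assume "i \<in> J"
          then show "?g z i \<in> - {0}"
            using PiE_mem[OF z, of i] \<open>z 1 \<noteq> 0\<close> by (cases "i = 0") simp_all
        next
          fix i assume "i \<notin> J"
          moreover from this J(1) have "i \<noteq> 0" by metis
          ultimately show "?g z i = undefined"
            using PiE_arb[OF z, of i] by simp
        qed
        then show "?g z \<in> {z \<in> J \<rightarrow>\<^sub>E - {0}. z 0 = z 1}" by simp
      qed
    qed
  qed
  also have "\<dots> = (CARD('a) - 1) ^ (n - 2)"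
  proof -
    have "card (J - {0}) = n - 2" using J by simp
    then show ?thesis using J by (simp add: card_torus)
  qed
  finally show ?thesis .
qed

section \<open>Zeros of forms with full support\<close>

lemma card_PiE_lessThan_Suc:
  fixes S :: "'a set"
  assumes "finite S"
  shows "card {y \<in> {..<Suc n} \<rightarrow>\<^sub>E S. R y} =
    (\<Sum>u\<in>S. card {y \<in> {..<n} \<rightarrow>\<^sub>E S. R (y(n := u))})"
proof -
  define T where "T = {..<n} \<rightarrow>\<^sub>E S"
  let ?h = "\<lambda>(u, y). y(n := u)"
  let ?D = "SIGMA u:S. {y \<in> T. R (y(n := u))}"
  have "{y \<in> {..<Suc n} \<rightarrow>\<^sub>E S. R y} = {y \<in> ?h ` (S \<times> T). R y}"
    unfolding lessThan_Suc PiE_insert_eq T_def ..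
  also have "\<dots> = ?h ` ?D" by auto
  finally have eq: "{y \<in> {..<Suc n} \<rightarrow>\<^sub>E S. R y} = ?h ` ?D" .
  have "?D \<subseteq> S \<times> T"
    by (rule Sigma_mono) simp_all
  moreover have "inj_on ?h (S \<times> T)"
    using inj_combinator[of n "{..<n}" "\<lambda>_. S"] by (simp add: T_def)
  ultimately have "inj_on ?h ?D" by (rule inj_on_subset[rotated])
  then have "card {y \<in> {..<Suc n} \<rightarrow>\<^sub>E S. R y} = card ?D"
    unfolding eq by (rule card_image)
  also have "\<dots> = (\<Sum>u\<in>S. card {y \<in> {..<n} \<rightarrow>\<^sub>E S. R (y(n := u))})"
    using assms by (subst card_SigmaI) (simp_all add: finite_PiE T_def)
  finally show ?thesis .
qed

text \<open>The values \<open>u\<close> and \<open>v\<close> are those of the last two coordinates.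
  As \<open>n\<close> is even, \<open>u\<close> enters the product directly and \<open>v\<close>
  inverted, which leaves the product \<open>c * v / u\<close> for the first \<open>n\<close>
  coordinates.\<close>

lemma card_balanced_rec:
  fixes a :: "nat \<Rightarrow> 'a::{field,finite}"
  assumes "even n"
  shows "card {y \<in> balanced (Suc (Suc n)) c. (\<Sum>i<Suc (Suc n). a i * y i) = s} =
    (\<Sum>v\<in>- {0}. \<Sum>u\<in>- {0}. card {y \<in> balanced n (c * v / u).
      (\<Sum>i<n. a i * y i) = s - a n * u - a (Suc n) * v})"
proof -
  have prod: "(\<Prod>i<Suc (Suc n). alt_inverse i ((y(n := u, Suc n := v)) i)) =
      (\<Prod>i<n. alt_inverse i (y i)) * u * inverse v" for y :: "nat \<Rightarrow> 'a" and u v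
  proof -
    have "(\<Prod>i<n. alt_inverse i ((y(n := u, Suc n := v)) i)) = (\<Prod>i<n. alt_inverse i (y i))"
      by (rule prod.cong) auto
    then show ?thesis
      unfolding prod.lessThan_Suc using assms by (simp only:) (simp add: alt_inverse_def)
  qed
  have sum: "(\<Sum>i<Suc (Suc n). a i * (y(n := u, Suc n := v)) i) =
      (\<Sum>i<n. a i * y i) + a n * u + a (Suc n) * v" for y u v
    by simp
  have "card {y \<in> balanced (Suc (Suc n)) c. (\<Sum>i<Suc (Suc n). a i * y i) = s} =
    card {y \<in> {..<Suc (Suc n)} \<rightarrow>\<^sub>E - {0}. (\<Prod>i<Suc (Suc n). alt_inverse i (y i)) = c \<and>
      (\<Sum>i<Suc (Suc n). a i * y i) = s}"
    by (simp only: balanced_def mem_Collect_eq conj_assoc)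
  also have "\<dots> = (\<Sum>v\<in>- {0}. \<Sum>u\<in>- {0}. card {y \<in> {..<n} \<rightarrow>\<^sub>E - {0}.
      (\<Prod>i<n. alt_inverse i (y i)) * u * inverse v = c \<and>
      (\<Sum>i<n. a i * y i) + a n * u + a (Suc n) * v = s})"
    unfolding card_PiE_lessThan_Suc[OF finite] prod sum ..
  also have "\<dots> = (\<Sum>v\<in>- {0}. \<Sum>u\<in>- {0}. card {y \<in> balanced n (c * v / u).
      (\<Sum>i<n. a i * y i) = s - a n * u - a (Suc n) * v})"
  proof (intro sum.cong refl)
    fix u v :: 'a assume "u \<in> - {0}" "v \<in> - {0}"
    then have "x * u * inverse v = c \<longleftrightarrow> x = c * v / u"
      "y + a n * u + a (Suc n) * v = s \<longleftrightarrow> y = s - a n * u - a (Suc n) * v" for x y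
      by (auto simp: field_simps)
    then show "card {y \<in> {..<n} \<rightarrow>\<^sub>E - {0}.
      (\<Prod>i<n. alt_inverse i (y i)) * u * inverse v = c \<and>
      (\<Sum>i<n. a i * y i) + a n * u + a (Suc n) * v = s} = card {y \<in> balanced n (c * v / u).
      (\<Sum>i<n. a i * y i) = s - a n * u - a (Suc n) * v}"
      by (simp only: balanced_def mem_Collect_eq conj_assoc)
  qed
  finally show ?thesis .
qed

section \<open>Counting pairs of nonzero field elements by real sums of indicators\<close>

lemma sum_nonzero_eq:
  "(\<Sum>u\<in>- {0::'a::{field,finite}}. of_bool (u = x)) = (of_bool (x \<noteq> 0) :: real)"
  by (simp add: of_bool_def)

lemma sum_nonzero_const:
  "(\<Sum>u\<in>- {0::'a::{field,finite}}. r) = (real CARD('a) - 1) * (r::real)"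
  by (simp add: card_nonzero of_nat_diff)

lemma sum_nonzero_neq:
  "(\<Sum>u\<in>- {0::'a::{field,finite}}. of_bool (u \<noteq> x)) =
    (real CARD('a) - 1 - of_bool (x \<noteq> 0))"
proof -
  have "(\<Sum>u\<in>- {0}. of_bool (u \<noteq> x)) = (\<Sum>u\<in>- {0::'a}. (1::real) - of_bool (u = x))"
    by (rule sum.cong) auto
  then show ?thesis by (simp only: sum_subtractf sum_nonzero_eq sum_nonzero_const mult_1_right)
qed

text \<open>Each \<open>v\<close> determines \<open>u\<close>, and \<open>u\<close> is nonzero
  unless \<open>v = - s / b'\<close>. This excludes one of the \<open>q - 1\<close> values of
  \<open>v\<close>, except for \<open>s = 0\<close>, when the excluded value is 0 anyway.\<close>

lemma sum_nonzero_line: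
  fixes b b' s :: "'a::{field,finite}"
  assumes "b \<noteq> 0" "b' \<noteq> 0"
  shows "(\<Sum>v\<in>- {0}. \<Sum>u\<in>- {0}. of_bool (s - b * u + b' * v = 0)) =
    real CARD('a) - 2 + of_bool (s = 0)"
proof -
  have "s - b * u + b' * v = 0 \<longleftrightarrow> u = (s + b' * v) / b" for u v
    using assms by (auto simp: field_simps)
  moreover have "(s + b' * v) / b \<noteq> 0 \<longleftrightarrow> v \<noteq> - s / b'" for v
    using assms by (auto simp: field_simps eq_neg_iff_add_eq_0)
  ultimately show ?thesis
    using assms by (simp only: sum_nonzero_eq sum_nonzero_neq) simp
qed

lemma sum_nonzero_ratio:
  fixes c K :: "'a::{field,finite}"
  assumes "c \<noteq> 0" "K \<noteq> 0"
  shows "(\<Sum>v\<in>- {0}. \<Sum>u\<in>- {0}. of_bool (c * v / u * K = 1)) = real CARD('a) - 1"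
proof -
  have "(\<Sum>v\<in>- {0}. \<Sum>u\<in>- {0}. of_bool (c * v / u * K = 1)) =
    (\<Sum>v\<in>- {0}. \<Sum>u\<in>- {0}. (of_bool (u = c * v * K) :: real))"
    by (intro sum.cong arg_cong[where f = of_bool] refl) (auto simp: field_simps)
  also have "\<dots> = (\<Sum>v\<in>- {0::'a}. 1)"
    unfolding sum_nonzero_eq using assms by (intro sum.cong) auto
  finally show ?thesis by (simp only: sum_nonzero_const mult_1_right)
qed

lemma sum_nonzero_line_ratio:
  fixes b b' c K s :: "'a::{field,finite}"
  assumes "b \<noteq> 0" "b' \<noteq> 0" "c \<noteq> 0" "K \<noteq> 0"
  shows "(\<Sum>v\<in>- {0}. \<Sum>u\<in>- {0}. of_bool (s - b * u + b' * v = 0) * of_bool (c * v / u * K = 1)) =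
    (real CARD('a) * of_bool (c * (K * b / b') = 1) * of_bool (s = 0) + 1
      - of_bool (c * (K * b / b') = 1) - of_bool (s = 0))"
proof -
  \<comment> \<open>Substituting \<open>u = c * v * K\<close> into the line equation gives
    \<open>s = d * v\<close>. For \<open>d = 0\<close> every \<open>v\<close> or no \<open>v\<close>
    is a solution, according to whether \<open>s = 0\<close>; otherwise \<open>v = s / d\<close> is
    the only candidate, and it is nonzero exactly if \<open>s\<close> is.\<close>
  define d where "d = b * c * K - b'"
  have d: "c * (K * b / b') = 1 \<longleftrightarrow> d = 0"
    using assms by (auto simp: d_def field_simps)
  have "(\<Sum>v\<in>- {0}. \<Sum>u\<in>- {0}. of_bool (s - b * u + b' * v = 0) * of_bool (c * v / u * K = 1)) =
    (\<Sum>v\<in>- {0}. \<Sum>u\<in>- {0}. of_bool (s = d * v) * (of_bool (u = c * v * K) :: real))"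
    by (intro sum.cong refl) (auto simp: field_simps d_def)
  also have "\<dots> = (\<Sum>v\<in>- {0::'a}. of_bool (s = d * v))"
    unfolding sum_distrib_left[symmetric] sum_nonzero_eq using assms by (intro sum.cong) auto
  also have "\<dots> = real CARD('a) * of_bool (d = 0) * of_bool (s = 0) + 1
      - of_bool (d = 0) - of_bool (s = 0)"
  proof (cases "d = 0")
    case False
    then have "s = d * v \<longleftrightarrow> v = s / d" for v by (auto simp: field_simps)
    then have "(\<Sum>v\<in>- {0::'a}. of_bool (s = d * v)) = (of_bool (s / d \<noteq> 0) :: real)"
      by (simp only: sum_nonzero_eq)
    then show ?thesis using False by simp
  qed (simp add: card_nonzero of_nat_diff)
  finally show ?thesis by (simp only: d)
qed

text \<open>The term \<open>(q - 1) ^ (2 * k + 1)\<close> is the size of the whole balanced set, so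
  it stands for an even distribution over the \<open>q\<close> values \<open>s\<close>; the
  remaining term sums to 0 over all \<open>s\<close>. The exceptional product is that of the point
  with coordinates \<open>1 / b i\<close>, at which the form vanishes because the signs alternate
  over an even length. In the induction the hypothesis depends on \<open>u\<close> and
  \<open>v\<close> only through the indicators of a line and of a ratio, so the three preceding
  counts suffice.\<close>

lemma card_balanced_form_eq:
  fixes b :: "nat \<Rightarrow> 'a::{field,finite}"
  assumes "\<And>i. i < 2 * Suc k \<Longrightarrow> b i \<noteq> 0" and "c \<noteq> 0"
  defines "q \<equiv> real CARD('a)"
  shows "q * real (card {y \<in> balanced (2 * Suc k) c. (\<Sum>i<2 * Suc k. (- 1) ^ i * b i * y i) = s}) =
    (q - 1) ^ (2 * k + 1) + (q * of_bool (s = 0) - 1) *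
      (q ^ Suc k * of_bool (c * (\<Prod>i<2 * Suc k. alt_inverse i (b i)) = 1) - (\<Sum>j<Suc k. q ^ j))"
  using assms(1,2)
proof (induction k arbitrary: c s)
  case 0
  define x :: real where "x = of_bool (c * (1 * b 0 / b 1) = 1)"
  define z :: real where "z = of_bool (s = 0)"
  have two: "2 * Suc 0 = Suc (Suc 0)" by simp
  \<comment> \<open>In length 0 there is a single function, with product 1 and sum 0, so the
    cardinality is an indicator. The factor 1 plays the part of \<open>K\<close> in
    \<open>sum_nonzero_line_ratio\<close>.\<close>
  have "card {y \<in> balanced 0 (c * v / u).
      (\<Sum>i<0. (- 1) ^ i * b i * y i) = s - (- 1) ^ 0 * b 0 * u - (- 1) ^ Suc 0 * b (Suc 0) * v}
    = of_bool (s - b 0 * u + b 1 * v = 0) * of_bool (c * v / u * 1 = 1)" for u v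
    by (auto simp: balanced_def)
  then have "card {y \<in> balanced (Suc (Suc 0)) c. (\<Sum>i<Suc (Suc 0). (- 1) ^ i * b i * y i) = s} =
    (\<Sum>v\<in>- {0}. \<Sum>u\<in>- {0}. of_bool (s - b 0 * u + b 1 * v = 0) * of_bool (c * v / u * 1 = 1))"
    unfolding card_balanced_rec[of 0, OF even_zero] by (simp only:)
  then have "real (card {y \<in> balanced (Suc (Suc 0)) c. (\<Sum>i<Suc (Suc 0). (- 1) ^ i * b i * y i) = s}) =
    (\<Sum>v\<in>- {0}. \<Sum>u\<in>- {0}. of_bool (s - b 0 * u + b 1 * v = 0) * of_bool (c * v / u * 1 = 1))"
    by (simp only: of_nat_sum of_nat_mult of_nat_of_bool)
  also have "\<dots> = q * x * z + 1 - x - z"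
    unfolding q_def x_def z_def by (rule sum_nonzero_line_ratio) (use 0 in auto)
  finally have card: "real (card {y \<in> balanced (Suc (Suc 0)) c.
      (\<Sum>i<Suc (Suc 0). (- 1) ^ i * b i * y i) = s}) = q * x * z + 1 - x - z" .
  have x: "x = of_bool (c * (\<Prod>i<Suc (Suc 0). alt_inverse i (b i)) = 1)"
    by (simp add: x_def alt_inverse_def divide_inverse)
  show ?case
    unfolding two card x[symmetric] z_def[symmetric] by (simp add: algebra_simps)
next
  case (Suc k)
  let ?n = "2 * Suc k"
  let ?b = "b ?n" and ?b' = "b (Suc ?n)"
  define K where "K = (\<Prod>i<?n. alt_inverse i (b i))"
  define Q where "Q = q ^ Suc k"
  define B where "B = (\<Sum>j<Suc k. q ^ j)"
  define A where "A = (q - 1) ^ (2 * k + 1)"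
  define x :: real where "x = of_bool (c * (K * ?b / ?b') = 1)"
  define z :: real where "z = of_bool (s = 0)"
  let ?L = "\<lambda>v u. of_bool (s - ?b * u + ?b' * v = 0) :: real"
  let ?R = "\<lambda>v u. of_bool (c * v / u * K = 1) :: real"
  have K: "K \<noteq> 0" unfolding K_def using Suc.prems by (subst prod_zero_iff) auto
  have b: "?b \<noteq> 0" "?b' \<noteq> 0" using Suc.prems(1) by auto
  have "q * real (card {y \<in> balanced (2 * Suc (Suc k)) c.
      (\<Sum>i<2 * Suc (Suc k). (- 1) ^ i * b i * y i) = s}) =
    (\<Sum>v\<in>- {0}. \<Sum>u\<in>- {0}. q * real (card {y \<in> balanced ?n (c * v / u).
      (\<Sum>i<?n. (- 1) ^ i * b i * y i) = s - ?b * u + ?b' * v}))"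
  proof -
    have two: "2 * Suc (Suc k) = Suc (Suc ?n)" by simp
    have sign: "(- 1) ^ ?n * b ?n = b ?n" "(- 1) ^ Suc ?n * b (Suc ?n) = - b (Suc ?n)"
      by simp_all
    have "even ?n" by simp
    show ?thesis
      unfolding two card_balanced_rec[OF \<open>even ?n\<close>] sign
      by (simp only: of_nat_sum sum_distrib_left mult_minus_left diff_minus_eq_add)
  qed
  also have "\<dots> = (\<Sum>v\<in>- {0}. \<Sum>u\<in>- {0}. A + (q * ?L v u - 1) * (Q * ?R v u - B))"
  proof (intro sum.cong refl)
    fix u v :: 'a assume "u \<in> - {0}" "v \<in> - {0}"
    then have "c * v / u \<noteq> 0" using Suc.prems(2) by simp
    moreover have "b i \<noteq> 0" if "i < 2 * Suc k" for i using Suc.prems(1) that by simp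
    ultimately show "q * real (card {y \<in> balanced ?n (c * v / u).
      (\<Sum>i<?n. (- 1) ^ i * b i * y i) = s - ?b * u + ?b' * v}) =
      A + (q * ?L v u - 1) * (Q * ?R v u - B)"
      unfolding A_def B_def Q_def K_def by (intro Suc.IH) auto
  qed
  \<comment> \<open>Expanding the product separates a constant, the two indicators and their
    product, each of which can be summed on its own.\<close>
  also have "\<dots> = (\<Sum>v\<in>- {0}. \<Sum>u\<in>- {0}. (A + B) + (q * Q * (?L v u * ?R v u) -
      q * B * ?L v u - Q * ?R v u))"
    by (intro sum.cong refl) (simp add: algebra_simps)
  also have "\<dots> = (q - 1) * ((q - 1) * A) + (q - 1) * ((q - 1) * B) + (q * Q * (q * x * z + 1 - x - z) -
      q * B * (q - 2 + z) - Q * (q - 1))"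
    unfolding sum.distrib sum_subtractf sum_distrib_left[symmetric] sum_nonzero_const
      sum_nonzero_line[OF b] sum_nonzero_ratio[OF Suc.prems(2) K]
      sum_nonzero_line_ratio[OF b Suc.prems(2) K] q_def x_def z_def ..
  \<comment> \<open>The coefficient of \<open>B\<close> collapses to \<open>1 - q * z\<close>. The
    terms in \<open>Q\<close> without \<open>x\<close> have the same coefficient, so
    \<open>Q = q ^ Suc k\<close> becomes the next summand of the geometric sum
    \<open>B\<close>.\<close>
  also have "\<dots> = (q - 1) * (q - 1) * A + (q * z - 1) * (q * Q * x - (B + Q))"
    by (simp add: algebra_simps)
  also have "(q - 1) * (q - 1) * A = (q - 1) ^ (2 * Suc k + 1)"
    by (simp add: A_def)
  also have "q * Q = q ^ Suc (Suc k)" by (simp add: Q_def)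
  also have "B + Q = (\<Sum>j<Suc (Suc k). q ^ j)" by (simp add: Q_def B_def)
  also have "x = of_bool (c * (\<Prod>i<2 * Suc (Suc k). alt_inverse i (b i)) = 1)"
    by (simp add: x_def K_def alt_inverse_def divide_inverse mult.assoc)
  finally show ?case unfolding z_def .
qed

section \<open>The toric set and its code\<close>

lemma proj_point_eq_iff:
  assumes "v \<in> carrier_vec n - {0\<^sub>v n}" "w \<in> carrier_vec n - {0\<^sub>v n}"
  shows "proj_point v = proj_point w \<longleftrightarrow> (\<exists>c. c \<noteq> 0 \<and> w = c \<cdot>\<^sub>v v)"
proof -
  have "dim_vec v = n" "dim_vec w = n" using assms by auto
  then show ?thesis
    unfolding proj_point_def using eq_equiv_class_iff[OF equiv_proj_rel assms] assms
    by (simp only:) (simp add: proj_rel_def)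
qed

lemma prod_lessThan_rotate:
  "(\<Prod>i<n. f (Suc i mod n)) = (\<Prod>i<n. f i :: 'a::comm_monoid_mult)"
proof (cases n)
  case (Suc m)
  have "(\<Prod>i<m. f (Suc i mod Suc m)) = (\<Prod>i<m. f (Suc i))"
    by (rule prod.cong) auto
  then have "(\<Prod>i<Suc m. f (Suc i mod Suc m)) = (\<Prod>i<m. f (Suc i)) * f 0"
    by (simp only: prod.lessThan_Suc mod_self)
  then show ?thesis unfolding Suc prod.lessThan_Suc_shift by (simp only: mult.commute)
qed simp

lemma balanced_nonzero: "y \<in> balanced n c \<Longrightarrow> i < n \<Longrightarrow> y i \<noteq> 0"
  using PiE_mem[of y "{..<n}" "\<lambda>_. - {0}" i] by (simp add: balanced_def)

text \<open>In the alternating product of the \<open>x i * x (Suc i mod (2 * k))\<close> each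
  \<open>x i\<close> occurs at two neighbouring positions of opposite parity and cancels.
  Conversely, \<open>x\<close> is found by going once around the cycle from \<open>x 0 = 1\<close>;
  the product condition says exactly that the cycle closes.\<close>

lemma cycle_toric_set_eq:
  assumes "k > 0"
  shows "cycle_toric_set k = (\<lambda>y. proj_point (vec (2 * k) y)) ` balanced (2 * k) (1::'a::field)"
proof (intro equalityI subsetI)
  let ?n = "2 * k"
  fix p :: "'a vec set" assume "p \<in> cycle_toric_set k"
  then obtain x where p: "p = proj_point (vec ?n (\<lambda>i. x i * x (Suc i mod ?n)))"
    and x: "\<forall>i<?n. x i \<noteq> 0" by (auto simp: cycle_toric_set_def)
  let ?y = "restrict (\<lambda>i. x i * x (Suc i mod ?n)) {..<?n}"
  have "p = proj_point (vec ?n ?y)"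
    unfolding p by (intro arg_cong[where f = proj_point] eq_vecI) simp_all
  moreover have "?y \<in> balanced ?n 1"
  proof -
    have "(\<Prod>i<?n. alt_inverse i (?y i)) =
        (\<Prod>i<?n. alt_inverse i (x i) * inverse (alt_inverse (Suc i mod ?n) (x (Suc i mod ?n))))"
    proof (rule prod.cong)
      fix i assume "i \<in> {..<?n}"
      \<comment> \<open>The cycle length is even, so parity alternates also at the
        wrap-around.\<close>
      moreover have "even (Suc i mod ?n) \<longleftrightarrow> odd i"
        by (simp add: dvd_mod_iff)
      ultimately show "alt_inverse i (?y i) =
          alt_inverse i (x i) * inverse (alt_inverse (Suc i mod ?n) (x (Suc i mod ?n)))"
        by (simp add: alt_inverse_def)
    qed simp
    also have "\<dots> = (\<Prod>i<?n. alt_inverse i (x i)) * (\<Prod>i<?n. inverse (alt_inverse i (x i)))"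
      unfolding prod.distrib prod_lessThan_rotate[of "\<lambda>i. inverse (alt_inverse i (x i))"] ..
    also have "\<dots> = (\<Prod>i<?n. 1)"
      unfolding prod.distrib[symmetric] using x by (intro prod.cong) simp_all
    finally have "(\<Prod>i<?n. alt_inverse i (?y i)) = 1" by simp
    moreover have "Suc i mod ?n < ?n" for i using assms by simp
    ultimately show ?thesis
      using x unfolding balanced_def mem_Collect_eq restrict_PiE_iff by simp
  qed
  ultimately show "p \<in> (\<lambda>y. proj_point (vec ?n y)) ` balanced ?n 1" by (rule image_eqI)
next
  let ?n = "2 * k"
  fix p :: "'a vec set" assume "p \<in> (\<lambda>y. proj_point (vec ?n y)) ` balanced ?n 1"
  then obtain y where p: "p = proj_point (vec ?n y)" and y: "y \<in> balanced ?n 1" by blast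
  \<comment> \<open>Closed form of the recursion \<open>x (Suc j) = y j / x j\<close> with
    \<open>x 0 = 1\<close>.\<close>
  define x where "x j = alt_inverse (Suc j) (\<Prod>i<j. alt_inverse i (y i))" for j
  have x0: "x j \<noteq> 0" if "j \<le> ?n" for j
  proof -
    have "y i \<noteq> 0" if "i < j" for i using balanced_nonzero[OF y, of i] that \<open>j \<le> ?n\<close> by simp
    then show ?thesis unfolding x_def alt_inverse_eq_0_iff by (subst prod_zero_iff) auto
  qed
  have step: "x j * x (Suc j) = y j" if "j < ?n" for j
    using x0[of j] that by (simp add: x_def) (simp add: alt_inverse_def)
  have "x ?n = x 0"
    using y by (simp add: x_def balanced_def)
  then have "x (Suc j mod ?n) = x (Suc j)" if "j < ?n" for j
    using that by (cases "Suc j = ?n") simp_all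
  then have "vec ?n y = vec ?n (\<lambda>i. x i * x (Suc i mod ?n))"
    by (intro eq_vecI) (simp_all add: step)
  then show "p \<in> cycle_toric_set k"
    unfolding p cycle_toric_set_def mem_Collect_eq
    by (intro exI[of _ x] conjI allI impI x0) simp_all
qed

text \<open>The representatives of a point that lie in the cone are all its nonzero multiples,
  because scaling preserves the alternating product. They are distinct since \<open>y 0\<close> is
  nonzero.\<close>

lemma card_proj_point_fiber:
  fixes y :: "nat \<Rightarrow> 'a::{field,finite}"
  assumes k: "k > 0" and y: "y \<in> balanced (2 * k) 1"
  shows "card {z \<in> balanced (2 * k) 1. proj_point (vec (2 * k) z) = proj_point (vec (2 * k) y)} =
    CARD('a) - 1"
proof -
  let ?n = "2 * k"
  let ?s = "\<lambda>c. restrict (\<lambda>i. c * y i) {..<?n}"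
  have carrier: "vec ?n z \<in> carrier_vec ?n - {0\<^sub>v ?n}" if "z \<in> balanced ?n (1::'a)" for z
  proof -
    have "vec ?n z $ 0 \<noteq> 0\<^sub>v ?n $ 0" using balanced_nonzero[OF that, of 0] k by simp
    then show ?thesis by auto
  qed
  have "{z \<in> balanced ?n 1. proj_point (vec ?n z) = proj_point (vec ?n y)} = ?s ` (- {0})"
  proof (intro equalityI subsetI)
    fix z assume "z \<in> {z \<in> balanced ?n 1. proj_point (vec ?n z) = proj_point (vec ?n y)}"
    then have z: "z \<in> balanced ?n 1"
      and "proj_point (vec ?n y) = proj_point (vec ?n z)" by simp_all
    then obtain c where c: "c \<noteq> 0" "vec ?n z = c \<cdot>\<^sub>v vec ?n y"
      using proj_point_eq_iff[OF carrier[OF y] carrier[OF z]] by auto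
    have "z = ?s c"
    proof
      fix i
      have "z i = undefined" if "i \<notin> {..<?n}"
        using z that PiE_arb[of z "{..<?n}" "\<lambda>_. - {0}" i] by (simp add: balanced_def)
      moreover have "z i = c * y i" if "i < ?n"
        using arg_cong[OF c(2), of "\<lambda>v. v $ i"] that by simp
      ultimately show "z i = ?s c i" by (cases "i < ?n") simp_all
    qed
    then show "z \<in> ?s ` (- {0})" using c by blast
  next
    fix z assume "z \<in> ?s ` (- {0})"
    then obtain c where c: "c \<noteq> 0" and z: "z = ?s c" by auto
    have "(\<Prod>i<?n. alt_inverse i (z i)) = (\<Prod>i<?n. alt_inverse i c * alt_inverse i (y i))"
      by (rule prod.cong) (simp_all add: z alt_inverse_mult)
    also have "\<dots> = 1"
      using y c by (simp add: prod.distrib prod_alt_inverse_const balanced_def)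
    finally have bal: "z \<in> balanced ?n 1"
      using c balanced_nonzero[OF y]
      unfolding balanced_def mem_Collect_eq z restrict_PiE_iff by simp
    have "vec ?n z = c \<cdot>\<^sub>v vec ?n y" by (rule eq_vecI) (simp_all add: z)
    then have "proj_point (vec ?n y) = proj_point (vec ?n z)"
      using proj_point_eq_iff[OF carrier[OF y] carrier[OF bal]] c by blast
    then show "z \<in> {z \<in> balanced ?n 1. proj_point (vec ?n z) = proj_point (vec ?n y)}"
      using bal by simp
  qed
  moreover have "inj_on ?s (- {0})"
  proof (rule inj_onI)
    fix c d assume "?s c = ?s d"
    from fun_cong[OF this, of 0] show "c = d" using k balanced_nonzero[OF y, of 0] by simp
  qed
  ultimately show ?thesis by (simp add: card_image card_nonzero)
qed

lemma card_balanced_proj_point: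
  fixes R :: "'a::{field,finite} vec set \<Rightarrow> bool"
  assumes k: "k > 0"
  shows "card {y \<in> balanced (2 * k) 1. R (proj_point (vec (2 * k) y))} =
    (CARD('a) - 1) * card {p \<in> cycle_toric_set k. R p}"
proof -
  let ?pt = "\<lambda>y. proj_point (vec (2 * k) y) :: 'a vec set"
  let ?S = "{y \<in> balanced (2 * k) 1. R (?pt y)}"
  have "card ?S = (\<Sum>y\<in>?S. 1)" by simp
  also have "\<dots> = (\<Sum>p\<in>?pt ` ?S. \<Sum>y\<in>{y \<in> ?S. ?pt y = p}. 1)"
    by (rule sum.image_gen) simp
  also have "\<dots> = (\<Sum>p\<in>?pt ` ?S. CARD('a) - 1)"
  proof (rule sum.cong)
    fix p assume "p \<in> ?pt ` ?S"
    then obtain y where y: "y \<in> balanced (2 * k) 1" "R (?pt y)" "p = ?pt y" by blast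
    then have "{y \<in> ?S. ?pt y = p} = {z \<in> balanced (2 * k) 1. ?pt z = ?pt y}" by auto
    then show "(\<Sum>y\<in>{y \<in> ?S. ?pt y = p}. 1) = CARD('a) - 1"
      using card_proj_point_fiber[OF k y(1)] by simp
  qed simp
  also have "?pt ` ?S = {p \<in> cycle_toric_set k. R p}"
    unfolding cycle_toric_set_eq[OF k] by blast
  finally show ?thesis by simp
qed

lemma card_cycle_toric_set:
  assumes "k > 0" and "CARD('a) > 1"
  shows "card (cycle_toric_set k :: 'a::{field,finite} vec set set) = (CARD('a) - 1) ^ (2 * k - 2)"
proof -
  have "(CARD('a) - 1) * card (cycle_toric_set k :: 'a vec set set) = (CARD('a) - 1) ^ Suc (2 * k - 2)"
    using card_balanced_proj_point[OF assms(1), of "\<lambda>_ :: 'a vec set. True"]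
      card_balanced[of "2 * k" "1::'a"] assms(1) by (simp add: Suc_diff_Suc numeral_2_eq_2)
  then show ?thesis using assms(2) by simp
qed

section \<open>Linear forms and the weights of their codewords\<close>

lemma single_1_eq_iff [simp]:
  "Poly_Mapping.single i (1::nat) = Poly_Mapping.single j 1 \<longleftrightarrow> i = j"
  by (metis lookup_single_eq lookup_single_not_eq one_neq_zero)

text \<open>Natural exponents with sum 1 consist of one exponent 1 and zeros, so every monomial of
  the form is a single variable.\<close>

lemma eval_linear_form:
  assumes "F \<in> forms n 1"
  shows "eval F v =
    (\<Sum>i<n. Poly_Mapping.lookup F (Poly_Mapping.single i 1) * v $ i)"
proof -
  let ?e = "\<lambda>i::nat. Poly_Mapping.single i (1::nat)"
  have "e \<in> ?e ` {..<n}" if "e \<in> Poly_Mapping.keys F" for e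
  proof -
    have e: "Poly_Mapping.keys e \<subseteq> {..<n}"
      "(\<Sum>i\<in>Poly_Mapping.keys e. Poly_Mapping.lookup e i) = 1"
      using assms that by (auto simp: forms_def)
    obtain i where i: "i \<in> Poly_Mapping.keys e" "Poly_Mapping.lookup e i = 1"
      "\<forall>j\<in>Poly_Mapping.keys e. i \<noteq> j \<longrightarrow> Poly_Mapping.lookup e j = 0"
      using e(2) unfolding sum_eq_1_iff[OF finite_keys] by blast
    have "Poly_Mapping.lookup e j = Poly_Mapping.lookup (?e i) j" for j
    proof (cases "i = j")
      case False
      then have "Poly_Mapping.lookup e j = 0"
        using i(3) in_keys_iff[of j e] by blast
      then show ?thesis using False by (simp add: lookup_single_not_eq)
    qed (use i(2) in auto)
    then have "e = ?e i" by (rule poly_mapping_eqI)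
    with i(1) e(1) show ?thesis by blast
  qed
  then have "Poly_Mapping.keys F \<subseteq> ?e ` {..<n}" by blast
  \<comment> \<open>The sum may run over all variables, as those that are not keys of
    \<open>F\<close> have coefficient 0.\<close>
  then have "eval F v = (\<Sum>e\<in>?e ` {..<n}. Poly_Mapping.lookup F e *
      (\<Prod>i\<in>Poly_Mapping.keys e. v $ i ^ Poly_Mapping.lookup e i))"
    unfolding eval_def by (intro sum.mono_neutral_left) (auto simp: in_keys_iff)
  also have "\<dots> = (\<Sum>i<n. Poly_Mapping.lookup F (?e i) * v $ i)"
    by (subst sum.reindex) (simp_all add: inj_on_def del: One_nat_def)
  finally show ?thesis .
qed

lemma ex_linear_form:
  obtains F :: "'a::field mpoly" where "F \<in> forms n 1"
    and "\<And>i. i < n \<Longrightarrow> Poly_Mapping.lookup F (Poly_Mapping.single i 1) = a i"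
proof
  let ?e = "\<lambda>i::nat. Poly_Mapping.single i (1::nat)"
  let ?F = "\<Sum>i<n. Poly_Mapping.single (?e i) (a i)"
  show "Poly_Mapping.lookup ?F (?e i) = a i" if "i < n" for i
    using that by (simp add: lookup_sum lookup_single when_def del: One_nat_def)
  have "Poly_Mapping.keys ?F \<subseteq> (\<Union>i<n. Poly_Mapping.keys (Poly_Mapping.single (?e i) (a i)))"
    by (rule keys_sum)
  also have "\<dots> \<subseteq> ?e ` {..<n}" by (auto split: if_splits)
  finally show "?F \<in> forms n 1" unfolding forms_def by fastforce
qed

lemma hamming_weight_eq_0_iff: "hamming_weight w = 0 \<longleftrightarrow> w = 0\<^sub>v (dim_vec w)"
proof
  assume "hamming_weight w = 0"
  then have "w $ j = 0" if "j < dim_vec w" for j using that by (auto simp: hamming_weight_def)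
  then show "w = 0\<^sub>v (dim_vec w)" by (intro eq_vecI) auto
next
  assume "w = 0\<^sub>v (dim_vec w)"
  then have "w $ j = 0" if "j < dim_vec w" for j using that by (metis index_zero_vec(1))
  then show "hamming_weight w = 0" by (auto simp: hamming_weight_def)
qed

text \<open>Coordinate 0 never vanishes on the toric set, so the quotient by \<open>var 0\<close> is
  zero exactly where \<open>F\<close> is. Each projective point accounts for
  \<open>CARD('a) - 1\<close> vectors of the cone. The additive form avoids truncated
  subtraction.\<close>

lemma hamming_weight_ev1:
  fixes P :: "nat \<Rightarrow> 'a::{field,finite} vec set"
  assumes k: "k > 0" and P: "bij_betw P {..<m} (cycle_toric_set k)" and F: "F \<in> forms (2 * k) 1"
  shows "(CARD('a) - 1) * hamming_weight (ev1 m P F) +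
    card {y \<in> balanced (2 * k) 1.
      (\<Sum>i<2 * k. Poly_Mapping.lookup F (Poly_Mapping.single i 1) * y i) = 0} =
    (CARD('a) - 1) ^ (2 * k - 1)"
proof -
  let ?n = "2 * k" and ?q = "eval_quotient F (var 0)"
  let ?f = "\<lambda>y. \<Sum>i<?n. Poly_Mapping.lookup F (Poly_Mapping.single i 1) * y i"
  have q: "?q (proj_point (vec ?n y)) \<noteq> 0 \<longleftrightarrow> ?f y \<noteq> 0" if "y \<in> balanced ?n 1" for y
  proof -
    have y0: "vec ?n y $ 0 \<noteq> 0" using balanced_nonzero[OF that, of 0] k by simp
    then have "vec ?n y \<noteq> 0\<^sub>v ?n" using k by (metis index_zero_vec(1) mult_pos_pos zero_less_numeral)
    then have "?q (proj_point (vec ?n y)) = eval F (vec ?n y) / vec ?n y $ 0"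
      using k eval_quotient_proj_point[OF F var_in_forms, of 0 "vec ?n y"] by (simp add: eval_var)
    then show ?thesis using y0 by (simp add: eval_linear_form[OF F])
  qed
  have "hamming_weight (ev1 m P F) = card {j \<in> {..<m}. ?q (P j) \<noteq> 0}"
    unfolding hamming_weight_def ev1_def by (intro arg_cong[where f = card]) auto
  also have "\<dots> = card {p \<in> cycle_toric_set k. ?q p \<noteq> 0}"
  proof (rule bij_betw_same_card)
    show "bij_betw P {j \<in> {..<m}. ?q (P j) \<noteq> 0} {p \<in> cycle_toric_set k. ?q p \<noteq> 0}"
    proof (rule bij_betw_imageI)
      show "inj_on P {j \<in> {..<m}. ?q (P j) \<noteq> 0}"
        using bij_betw_imp_inj_on[OF P] by (rule inj_on_subset) auto
      have "{p \<in> P ` {..<m}. ?q p \<noteq> 0} = P ` {j \<in> {..<m}. ?q (P j) \<noteq> 0}" by blast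
      then show "P ` {j \<in> {..<m}. ?q (P j) \<noteq> 0} = {p \<in> cycle_toric_set k. ?q p \<noteq> 0}"
        unfolding bij_betw_imp_surj_on[OF P] by (rule sym)
    qed
  qed
  finally have "(CARD('a) - 1) * hamming_weight (ev1 m P F) =
      card {y \<in> balanced ?n 1. ?q (proj_point (vec ?n y)) \<noteq> 0}"
    using card_balanced_proj_point[OF k, of "\<lambda>p. ?q p \<noteq> 0"] by simp
  also have "{y \<in> balanced ?n 1. ?q (proj_point (vec ?n y)) \<noteq> 0} = {y \<in> balanced ?n 1. ?f y \<noteq> 0}"
    using q by blast
  finally have "(CARD('a) - 1) * hamming_weight (ev1 m P F) = card {y \<in> balanced ?n 1. ?f y \<noteq> 0}" .
  moreover have "card {y \<in> balanced ?n 1. ?f y \<noteq> 0} + card {y \<in> balanced ?n 1. ?f y = 0} =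
      card (balanced ?n (1::'a))"
  proof -
    have "{y \<in> balanced ?n 1. ?f y \<noteq> 0} = balanced ?n 1 - {y \<in> balanced ?n 1. ?f y = 0}"
      by blast
    moreover have "{y \<in> balanced ?n 1. ?f y = 0} \<subseteq> balanced ?n 1"
      by (rule Collect_restrict)
    ultimately show ?thesis
      by (simp only: card_Diff_subset[OF finite_subset] finite_balanced card_mono le_add_diff_inverse2)
  qed
  moreover have "card (balanced ?n (1::'a)) = (CARD('a) - 1) ^ (2 * k - 1)"
    using k by (intro card_balanced) auto
  ultimately show ?thesis by (simp only:)
qed

section \<open>The largest number of zeros\<close>

text \<open>This is the correction term of \<open>card_balanced_form_eq\<close> at
  \<open>s = 0\<close>, where its first factor is \<open>q - 1\<close>; \<open>x\<close> stands for
  the indicator of the exceptional product.\<close>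

lemma sum_geometric_bound:
  fixes q :: real
  assumes "q > 1" "x \<le> 1"
  shows "(q - 1) * (q ^ k * x - (\<Sum>j<k. q ^ j)) \<le> q ^ k * (q - 2) + 1"
    and "(q - 1) * (q ^ k - (\<Sum>j<k. q ^ j)) = q ^ k * (q - 2) + 1"
proof -
  have "(q - 1) * (\<Sum>j<k. q ^ j) = q ^ k - 1"
    by (rule power_diff_1_eq[symmetric])
  then show eq: "(q - 1) * (q ^ k - (\<Sum>j<k. q ^ j)) = q ^ k * (q - 2) + 1"
    unfolding right_diff_distrib by (simp add: algebra_simps)
  have "q ^ k * x \<le> q ^ k" using assms by (simp add: mult_left_le)
  then have "(q - 1) * (q ^ k * x - (\<Sum>j<k. q ^ j)) \<le> (q - 1) * (q ^ k - (\<Sum>j<k. q ^ j))"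
    using assms by (intro mult_left_mono) auto
  then show "(q - 1) * (q ^ k * x - (\<Sum>j<k. q ^ j)) \<le> q ^ k * (q - 2) + 1"
    unfolding eq .
qed

text \<open>The first number bounds the zeros, on the affine cone over the toric set, of forms with a
  vanishing coefficient, the second those of forms with full support.\<close>

definition max_zeros :: "real \<Rightarrow> nat \<Rightarrow> real" where
  "max_zeros q k =
    max ((q - 1) ^ (2 * k - 2)) (((q - 1) ^ (2 * k - 1) + q ^ k * (q - 2) + 1) / q)"

lemma card_balanced_zeros_le_max_zeros:
  fixes a :: "nat \<Rightarrow> 'a::{field,finite}"
  assumes k: "k > 0" and q: "q = real CARD('a)" "q > 2" and i: "i < 2 * k" "a i \<noteq> 0"
  shows "real (card {y \<in> balanced (2 * k) 1. (\<Sum>i<2 * k. a i * y i) = 0}) \<le> max_zeros q k"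
proof (cases "\<exists>f<2 * k. a f = 0")
  case True
  then obtain f where f: "f < 2 * k" "a f = 0" by blast
  have "card {y \<in> balanced (2 * k) 1. (\<Sum>i<2 * k. a i * y i) = 0} \<le> (CARD('a) - 1) ^ (2 * k - 2)"
    using f i by (intro card_balanced_linear_zeros_le) simp_all
  then have "real (card {y \<in> balanced (2 * k) 1. (\<Sum>i<2 * k. a i * y i) = 0}) \<le>
      real ((CARD('a) - 1) ^ (2 * k - 2))"
    by (rule of_nat_mono)
  also have "\<dots> = (q - 1) ^ (2 * k - 2)" using q by (simp add: of_nat_diff)
  finally show ?thesis by (simp add: max_zeros_def)
next
  case False
  obtain j where j: "k = Suc j" using k by (cases k) auto
  \<comment> \<open>With the alternating sign absorbed into the coefficients,
    \<open>card_balanced_form_eq\<close> covers every form with full support.\<close>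
  define b where "b i = (- 1) ^ i * a i" for i
  have ab: "(- 1) ^ i * b i = a i" for i
    by (simp add: b_def flip: mult.assoc power_add)
  have "b i \<noteq> 0" if "i < 2 * Suc j" for i using False that j by (auto simp: b_def)
  then have "q * real (card {y \<in> balanced (2 * k) 1. (\<Sum>i<2 * k. a i * y i) = 0}) =
      (q - 1) ^ (2 * j + 1) + (q * of_bool (0 = (0::'a)) - 1) *
      (q ^ k * of_bool (1 * (\<Prod>i<2 * k. alt_inverse i (b i)) = 1) - (\<Sum>j<k. q ^ j))"
    using card_balanced_form_eq[of j b 1 0] unfolding j q(1) ab by simp
  also have "\<dots> \<le> (q - 1) ^ (2 * k - 1) + q ^ k * (q - 2) + 1"
    using sum_geometric_bound(1)[of q "of_bool (1 * (\<Prod>i<2 * k. alt_inverse i (b i)) = 1)" k] q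
    by (simp add: j)
  finally show ?thesis using q by (simp add: max_zeros_def field_simps le_max_iff_disj)
qed

lemma max_zeros_attained:
  assumes k: "k \<ge> 2" and q: "q = real CARD('a)" "q > 2"
  obtains a :: "nat \<Rightarrow> 'a::{field,finite}" where
    "real (card {y \<in> balanced (2 * k) 1. (\<Sum>i<2 * k. a i * y i) = 0}) = max_zeros q k"
proof (cases "(q - 1) ^ (2 * k - 2) \<ge> ((q - 1) ^ (2 * k - 1) + q ^ k * (q - 2) + 1) / q")
  case True
  \<comment> \<open>The difference of the first two variables. It has a vanishing coefficient
    because \<open>2 * k > 2\<close>.\<close>
  define a :: "nat \<Rightarrow> 'a" where "a i = (if i = 0 then 1 else if i = 1 then - 1 else 0)" for i
  have "(\<Sum>i<2 * k. a i * y i) = y 0 - y 1" for y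
  proof -
    have "(\<Sum>i<2 * k. a i * y i) = (\<Sum>i\<in>{0, 1}. a i * y i)"
      using k by (intro sum.mono_neutral_right) (auto simp: a_def)
    then show ?thesis by (simp add: a_def)
  qed
  then have "{y \<in> balanced (2 * k) 1. (\<Sum>i<2 * k. a i * y i) = 0} =
      {y \<in> balanced (2 * k) 1. y 0 = y 1}"
    by (simp only: right_minus_eq)
  then have "real (card {y \<in> balanced (2 * k) 1. (\<Sum>i<2 * k. a i * y i) = 0}) =
      (q - 1) ^ (2 * k - 2)"
    using k q card_balanced_equal_coordinates[of "2 * k" "1::'a"] by (simp add: of_nat_diff)
  then show ?thesis using True by (intro that[of a]) (simp add: max_zeros_def)
next
  case False
  obtain j where j: "k = Suc j" using k by (cases k) auto
  \<comment> \<open>With all \<open>b i = 1\<close> the product of the coefficients is 1, so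
    \<open>c = 1\<close> is the exceptional product and the indicator takes its larger
    value.\<close>
  have "q * real (card {y \<in> balanced (2 * k) (1::'a). (\<Sum>i<2 * k. (- 1) ^ i * 1 * y i) = 0}) =
      (q - 1) ^ (2 * j + 1) + (q * of_bool (0 = (0::'a)) - 1) *
      (q ^ k * of_bool (1 * (\<Prod>i<2 * k. alt_inverse i 1) = (1::'a)) - (\<Sum>j<k. q ^ j))"
    unfolding j q(1) by (rule card_balanced_form_eq) simp_all
  also have "\<dots> = (q - 1) ^ (2 * k - 1) + q ^ k * (q - 2) + 1"
    using sum_geometric_bound(2)[of q 1 k] q by (simp add: j)
  finally have "real (card {y \<in> balanced (2 * k) (1::'a). (\<Sum>i<2 * k. (- 1) ^ i * 1 * y i) = 0}) =
      ((q - 1) ^ (2 * k - 1) + q ^ k * (q - 2) + 1) / q"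
    using q by (simp add: field_simps)
  then show ?thesis using False by (intro that[of "\<lambda>i. (- 1) ^ i * 1"]) (simp add: max_zeros_def)
qed

section \<open>Comparing the powers of \<open>q - 1\<close> with
  \<open>q ^ k * (q - 2) + 1\<close>\<close>

lemma power_bound_Suc:
  fixes q :: real
  assumes "q \<ge> 3" and "q ^ k * (q - 2) + 1 \<le> x"
  shows "q ^ Suc k * (q - 2) + 1 < (q - 1)\<^sup>2 * x"
proof -
  have x: "x \<ge> 1" using assms by (smt (verit) mult_nonneg_nonneg zero_le_power)
  \<comment> \<open>Passing from \<open>k\<close> to \<open>Suc k\<close> multiplies the left side
    by less than \<open>q\<close>, but the bound by \<open>(q - 1)\<^sup>2\<close>, which is at
    least \<open>q\<close> once \<open>q \<ge> 3\<close>.\<close>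
  have "q ^ Suc k * (q - 2) + 1 < q * (q ^ k * (q - 2) + 1)" using assms by (simp add: algebra_simps)
  also have "\<dots> \<le> q * x" using assms by (intro mult_left_mono) auto
  also have "\<dots> \<le> (q - 1)\<^sup>2 * x"
  proof (rule mult_right_mono)
    have "(q - 1)\<^sup>2 - q = (q - 3) * q + 1" by (simp add: power2_eq_square algebra_simps)
    moreover have "(q - 3) * q \<ge> 0" using assms by simp
    ultimately show "q \<le> (q - 1)\<^sup>2" by linarith
  qed (use x in simp)
  finally show ?thesis .
qed

lemma power_bound_all:
  fixes q :: real
  assumes "q \<ge> 3" "k \<ge> 2"
  shows "q ^ k * (q - 2) + 1 < (q - 1) ^ (2 * k)"
  using assms(2)
proof (induction k rule: nat_induct_at_least)
  case base
  have "(q - 1) ^ (2 * 2) - (q ^ 2 * (q - 2) + 1) = q * (q - 1) * (q - 2)\<^sup>2"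
    by (simp add: power_numeral_reduce algebra_simps)
  moreover have "q * (q - 1) * (q - 2)\<^sup>2 > 0" using assms(1) by simp
  ultimately show ?case by linarith
next
  case (Suc k)
  then show ?case
    using power_bound_Suc[of q k "(q - 1) ^ (2 * k)"] assms(1)
    by (simp add: power2_eq_square mult.assoc)
qed

lemma power_bound_large:
  fixes q :: real
  assumes "q \<ge> 3" "k \<ge> 5"
  shows "q ^ k * (q - 2) + 1 \<le> (q - 1) ^ (2 * k - 2)"
  using assms(2)
proof (induction k rule: nat_induct_at_least)
  case base
  \<comment> \<open>Expanded around the smallest admissible value \<open>q = 3\<close>, the
    difference is a polynomial in \<open>t \<ge> 0\<close> with nonnegative coefficients.\<close>
  define t where "t = q - 3"
  have q: "q = t + 3" by (simp add: t_def)
  have "(q - 1) ^ 8 - (q ^ 5 * (q - 2) + 1) =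
      12 + 376 * t + 1117 * t ^ 2 + 1432 * t ^ 3 + 1015 * t ^ 4 + 432 * t ^ 5 + 111 * t ^ 6
      + 16 * t ^ 7 + t ^ 8"
    unfolding q by (simp add: power_numeral_reduce algebra_simps)
  moreover have "\<dots> \<ge> 0" using assms(1) by (intro add_nonneg_nonneg) (auto simp: t_def)
  ultimately show ?case by simp
next
  case (Suc k)
  moreover have "(q - 1) ^ (2 * Suc k - 2) = (q - 1)\<^sup>2 * (q - 1) ^ (2 * k - 2)"
  proof -
    have "2 * Suc k - 2 = 2 + (2 * k - 2)" using Suc(1) by simp
    then show ?thesis by (simp only: power_add)
  qed
  ultimately show ?case using power_bound_Suc[of q k "(q - 1) ^ (2 * k - 2)"] assms(1) by simp
qed

text \<open>The bound fails at \<open>q = 3\<close>, where it would compare 82 with 64; this is why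
  \<open>k = 4\<close> belongs to both cases of the final formula. The expansion is therefore around
  \<open>q = 4\<close>.\<close>

lemma power_bound_4:
  fixes q :: real
  assumes "q \<ge> 4"
  shows "q ^ 4 * (q - 2) + 1 \<le> (q - 1) ^ 6"
proof -
  define t where "t = q - 4"
  have q: "q = t + 4" by (simp add: t_def)
  have "(q - 1) ^ 6 - (q ^ 4 * (q - 2) + 1) =
      216 + 690 * t + 767 * t ^ 2 + 412 * t ^ 3 + 117 * t ^ 4 + 17 * t ^ 5 + t ^ 6"
    unfolding q by (simp add: power_numeral_reduce algebra_simps)
  moreover have "\<dots> \<ge> 0" using assms by (intro add_nonneg_nonneg) (auto simp: t_def)
  ultimately show ?thesis by linarith
qed

lemma power_bound_small:
  fixes q :: real
  assumes "q \<ge> 3" "k = 2 \<or> k = 3 \<or> k = 4 \<and> q = 3"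
  shows "(q - 1) ^ (2 * k - 2) \<le> q ^ k * (q - 2) + 1"
  using assms(2)
proof (elim disjE conjE)
  assume k: "k = 2"
  have "q ^ 2 * (q - 2) + 1 - (q - 1) ^ 2 = q * (q - 1) * (q - 2)"
    by (simp add: power_numeral_reduce algebra_simps)
  moreover have "q * (q - 1) * (q - 2) \<ge> 0" using assms(1) by simp
  ultimately show ?thesis unfolding k by simp
next
  assume k: "k = 3"
  have "q ^ 3 * (q - 2) + 1 - (q - 1) ^ 4 = 2 * (q * (q - 1) * (q - 2))"
    by (simp add: power_numeral_reduce algebra_simps)
  moreover have "q * (q - 1) * (q - 2) \<ge> 0" using assms(1) by simp
  ultimately show ?thesis unfolding k by simp
\<comment> \<open>For \<open>k = 4\<close> and \<open>q = 3\<close> the inequality is the numerical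
  one between 64 and 82.\<close>
qed simp

text \<open>Since \<open>(q - 1) ^ (2 * k - 1)\<close> is \<open>q - 1\<close> times
  \<open>(q - 1) ^ (2 * k - 2)\<close>, the second argument of the maximum exceeds the first by
  \<open>(q ^ k * (q - 2) + 1 - (q - 1) ^ (2 * k - 2)) / q\<close>.\<close>

lemma max_zeros_cases:
  fixes q :: real
  assumes "q > 0" "k > 0"
  shows "q ^ k * (q - 2) + 1 \<le> (q - 1) ^ (2 * k - 2) \<Longrightarrow> max_zeros q k = (q - 1) ^ (2 * k - 2)"
    and "(q - 1) ^ (2 * k - 2) \<le> q ^ k * (q - 2) + 1 \<Longrightarrow>
      max_zeros q k = ((q - 1) ^ (2 * k - 1) + q ^ k * (q - 2) + 1) / q"
proof -
  have "2 * k - 1 = Suc (2 * k - 2)" using assms(2) by simp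
  then have eq: "(q - 1) ^ (2 * k - 1) = q * (q - 1) ^ (2 * k - 2) - (q - 1) ^ (2 * k - 2)"
    by (simp add: left_diff_distrib)
  show "max_zeros q k = (q - 1) ^ (2 * k - 2)"
    if "q ^ k * (q - 2) + 1 \<le> (q - 1) ^ (2 * k - 2)"
    using that assms(1) unfolding max_zeros_def eq
    by (intro max_absorb1) (simp add: divide_le_eq mult.commute)
  show "max_zeros q k = ((q - 1) ^ (2 * k - 1) + q ^ k * (q - 2) + 1) / q"
    if "(q - 1) ^ (2 * k - 2) \<le> q ^ k * (q - 2) + 1"
    using that assms(1) unfolding max_zeros_def eq
    by (intro max_absorb2) (simp add: le_divide_eq mult.commute)
qed

text \<open>The right side is the size of the whole cone. Hence a form with the largest number of
  zeros still has a nonzero codeword.\<close>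

lemma max_zeros_less:
  fixes q :: real
  assumes "q \<ge> 3" "k \<ge> 2"
  shows "max_zeros q k < (q - 1) ^ (2 * k - 1)"
proof -
  have "(q - 1) ^ (2 * k - 2) < (q - 1) ^ (2 * k - 1)"
    using assms by (intro power_strict_increasing) auto
  moreover have "2 * k = Suc (2 * k - 1)" using assms(2) by simp
  then have "(q - 1) ^ (2 * k) = q * (q - 1) ^ (2 * k - 1) - (q - 1) ^ (2 * k - 1)"
    by (metis left_diff_distrib mult_1 power_Suc)
  then have "((q - 1) ^ (2 * k - 1) + q ^ k * (q - 2) + 1) / q < (q - 1) ^ (2 * k - 1)"
    using power_bound_all[OF assms] assms(1) by (simp add: divide_less_eq mult.commute)
  ultimately show ?thesis by (simp add: max_zeros_def)
qed

section \<open>The minimum distance\<close>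

lemma min_distance_eval_code1:
  fixes P :: "nat \<Rightarrow> 'a::{field,finite} vec set"
  assumes k: "k \<ge> 2" and q: "q = real CARD('a)" "q > 2"
    and P: "bij_betw P {..<m} (cycle_toric_set k)"
  shows "(q - 1) * real (min_distance (eval_code1 (2 * k) m P)) =
    (q - 1) ^ (2 * k - 1) - max_zeros q k"
proof -
  let ?a = "\<lambda>F :: 'a mpoly. \<lambda>i. Poly_Mapping.lookup F (Poly_Mapping.single i 1)"
  let ?Z = "\<lambda>a :: nat \<Rightarrow> 'a. {y \<in> balanced (2 * k) 1. (\<Sum>i<2 * k. a i * y i) = 0}"
  let ?C = "eval_code1 (2 * k) m P"
  have k0: "k > 0" using k by simp
  have q3: "q \<ge> 3" using q by simp
  have weight: "(q - 1) * real (hamming_weight (ev1 m P F)) =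
      (q - 1) ^ (2 * k - 1) - real (card (?Z (?a F)))" if "F \<in> forms (2 * k) 1" for F
    using arg_cong[OF hamming_weight_ev1[OF k0 P that], of real] q by (simp add: of_nat_diff)
  obtain a :: "nat \<Rightarrow> 'a" where a: "real (card (?Z a)) = max_zeros q k"
    using max_zeros_attained[OF k q] .
  obtain F0 :: "'a mpoly" where F0: "F0 \<in> forms (2 * k) 1" "\<And>i. i < 2 * k \<Longrightarrow> ?a F0 i = a i"
    by (rule ex_linear_form[of "2 * k" a]) blast
  have "(\<Sum>i<2 * k. ?a F0 i * y i) = (\<Sum>i<2 * k. a i * y i)" for y
    by (rule sum.cong) (use F0(2) in simp_all)
  then have "(q - 1) * real (hamming_weight (ev1 m P F0)) = (q - 1) ^ (2 * k - 1) - max_zeros q k"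
    using weight[OF F0(1)] a by (simp only:)
  moreover have "min_distance ?C = hamming_weight (ev1 m P F0)"
    unfolding min_distance_def
  proof (rule cInf_eq_minimum)
    \<comment> \<open>The infimum runs over nonzero words only, so the extremal word has to be shown
      to be one of them.\<close>
    have "hamming_weight (ev1 m P F0) \<noteq> 0"
      using calculation max_zeros_less[OF q3 k] by (intro notI) simp
    then show "hamming_weight (ev1 m P F0) \<in> hamming_weight ` {w \<in> ?C. w \<noteq> 0\<^sub>v (dim_vec w)}"
      using F0(1) by (intro imageI) (auto simp: hamming_weight_eq_0_iff eval_code1_def)
  next
    fix d assume "d \<in> hamming_weight ` {w \<in> ?C. w \<noteq> 0\<^sub>v (dim_vec w)}"
    then obtain F where F: "F \<in> forms (2 * k) 1" and d: "d = hamming_weight (ev1 m P F)"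
      and nz: "ev1 m P F \<noteq> 0\<^sub>v (dim_vec (ev1 m P F))"
      unfolding eval_code1_def by blast
    have "d \<noteq> 0" using nz unfolding d hamming_weight_eq_0_iff .
    \<comment> \<open>The bound on zeros needs a nonzero coefficient. If all of them were 0, the
      whole cone would consist of zeros and the weight would be 0.\<close>
    have "\<exists>i<2 * k. ?a F i \<noteq> 0"
    proof (rule ccontr)
      assume "\<not> (\<exists>i<2 * k. ?a F i \<noteq> 0)"
      then have "?Z (?a F) = balanced (2 * k) 1" by simp
      then have "(q - 1) * real d = 0"
        using weight[OF F] card_balanced[of "2 * k" "1::'a"] k0 q d by (simp add: of_nat_diff)
      then show False using \<open>d \<noteq> 0\<close> q by simp
    qed
    then obtain i where i: "i < 2 * k" "?a F i \<noteq> 0" by blast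
    have "real (card (?Z (?a F))) \<le> max_zeros q k"
      by (rule card_balanced_zeros_le_max_zeros[where a = "?a F", OF k0 q i])
    then have "(q - 1) * real (hamming_weight (ev1 m P F0)) \<le> (q - 1) * real d"
      using calculation weight[OF F] unfolding d by linarith
    then show "hamming_weight (ev1 m P F0) \<le> d" using q by simp
  qed
  ultimately show ?thesis by (simp only:)
qed

theorem theorem3p1:
  fixes k m q :: nat and P :: "nat \<Rightarrow> 'a::{field,finite} vec set"
  assumes "q = CARD('a)" and "q > 2" and "k \<ge> 2"
    and "bij_betw P {..<m} (cycle_toric_set k)"
  shows "m = (q - 1) ^ (2 * k - 2) \<and>
    (k = 4 \<and> q > 3 \<or> k \<ge> 5 \<longrightarrow>
      real (min_distance (eval_code1 (2 * k) m P)) = (real q - 1) ^ (2 * k - 3) * (real q - 2)) \<and>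
    (k = 2 \<or> k = 3 \<or> k = 4 \<and> q = 3 \<longrightarrow>
      real (min_distance (eval_code1 (2 * k) m P)) =
        ((real q - 1) ^ (2 * k) - real q ^ k * (real q - 2) - 1) / (real q * (real q - 1)))"
proof (intro conjI impI)
  let ?d = "real (min_distance (eval_code1 (2 * k) m P))"
  have q: "real q = real CARD('a)" "real q > 2" and q3: "real q \<ge> 3" using assms(1,2) by simp_all
  have k: "k > 0" "real q > 0" using assms by simp_all
  note d = min_distance_eval_code1[OF assms(3) q assms(4)]
  have "m = card (cycle_toric_set k :: 'a vec set set)"
    using bij_betw_same_card[OF assms(4)] by simp
  then show "m = (q - 1) ^ (2 * k - 2)"
    using card_cycle_toric_set[of k, where 'a = 'a] assms by simp
  show "?d = (real q - 1) ^ (2 * k - 3) * (real q - 2)" if large: "k = 4 \<and> q > 3 \<or> k \<ge> 5"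
  proof -
    have "real q ^ k * (real q - 2) + 1 \<le> (real q - 1) ^ (2 * k - 2)"
      using large power_bound_4[of "real q"] power_bound_large[OF q3, of k] by auto
    then have "(real q - 1) * ?d = (real q - 1) ^ (2 * k - 1) - (real q - 1) ^ (2 * k - 2)"
      unfolding d by (simp only: max_zeros_cases(1)[OF k(2,1)])
    \<comment> \<open>Since \<open>k \<ge> 2\<close>, the subtraction in \<open>2 * k - 3\<close> is
      not truncated, and this power can be factored out of both terms.\<close>
    also have "2 * k - 1 = Suc (Suc (2 * k - 3))" using assms(3) by simp
    also have "2 * k - 2 = Suc (2 * k - 3)" using assms(3) by simp
    finally have "(real q - 1) * ?d = (real q - 1) * ((real q - 1) ^ (2 * k - 3) * (real q - 2))"
      by (simp add: algebra_simps)
    then show ?thesis using q by simp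
  qed
  show "?d = ((real q - 1) ^ (2 * k) - real q ^ k * (real q - 2) - 1) / (real q * (real q - 1))"
    if small: "k = 2 \<or> k = 3 \<or> k = 4 \<and> q = 3"
  proof -
    have "(real q - 1) ^ (2 * k - 2) \<le> real q ^ k * (real q - 2) + 1"
      using small by (intro power_bound_small[OF q3]) auto
    then have dz: "(real q - 1) * ?d = (real q - 1) ^ (2 * k - 1) -
        ((real q - 1) ^ (2 * k - 1) + real q ^ k * (real q - 2) + 1) / real q"
      unfolding d by (simp only: max_zeros_cases(2)[OF k(2,1)])
    \<comment> \<open>Both denominators are cleared; the two terms in
      \<open>(real q - 1) ^ (2 * k - 1)\<close> then combine to
      \<open>(real q - 1) ^ (2 * k)\<close>.\<close>
    have "(real q * (real q - 1)) * ?d = real q * ((real q - 1) * ?d)"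
      by (rule mult.assoc)
    also have "\<dots> = real q * (real q - 1) ^ (2 * k - 1) -
        real q * (((real q - 1) ^ (2 * k - 1) + real q ^ k * (real q - 2) + 1) / real q)"
      unfolding dz by (rule right_diff_distrib)
    also have "real q * (((real q - 1) ^ (2 * k - 1) + real q ^ k * (real q - 2) + 1) / real q) =
        (real q - 1) ^ (2 * k - 1) + real q ^ k * (real q - 2) + 1"
      using k(2) by simp
    also have "real q * (real q - 1) ^ (2 * k - 1) -
        ((real q - 1) ^ (2 * k - 1) + real q ^ k * (real q - 2) + 1) =
        (real q - 1) * (real q - 1) ^ (2 * k - 1) - real q ^ k * (real q - 2) - 1"
      by (simp add: left_diff_distrib)
    also have "(real q - 1) * (real q - 1) ^ (2 * k - 1) = (real q - 1) ^ (2 * k)"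
      using k(1) by (simp flip: power_Suc)
    finally show ?thesis using q by (simp add: eq_divide_eq mult.commute)
  qed
qed

end
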